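(* Let $B\subseteq \mathbb{N}^+$ be an infinite set with increasing enumeration $(b_n: n \in \mathbb{N}^+)$ and suppose that there exists $\lambda>1$ such that $$\log\left(\frac{b_{n+1}}{b_n}\right)\gg \frac{(\log n)^\lambda}{n}.$$ Then for each $\alpha \in [0,1]$ there exists a set $A\subseteq \mathbb{N}^+$ such that $\mathsf{d}(A)=0$ and $\mathsf{d}(A+B)=\alpha$.
   Context: $\mathbb{N}^+=\{1,2,\ldots\}$. For $S\subseteq \mathbb{N}^+$, the asymptotic density is $\mathsf{d}(S):=\lim_{n\to\infty} |S\cap[1,n]|/n$, provided the limit exists; "$\mathsf{d}(S)=\alpha$" means that the limit exists and equals $\alpha$. The sumset is $A+B:=\{x+y: x\in A, y\in B\}$. For sequences of nonnegative reals, $f(n)\gg g(n)$ means that there exists a constant $c>0$ such that $f(n)\ge c\,g(n)$ for all sufficiently large $n$. *)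

theory Defs
  imports "HOL-Analysis.Analysis" "HOL-Library.Set_Algebras"
begin

definition has_density :: "nat set \<Rightarrow> real \<Rightarrow> bool" where
  "has_density S \<alpha> \<longleftrightarrow>
     (\<lambda>n::nat. real (card (S \<inter> {1..n})) / real n) \<longlonglongrightarrow> \<alpha>"

text \<open>Vinogradov's notation for sequences of nonnegative reals. Unlike the library's
  \<open>\<Omega>(g)\<close>, no absolute values are taken.\<close>

definition vinogradov_gg :: "(nat \<Rightarrow> real) \<Rightarrow> (nat \<Rightarrow> real) \<Rightarrow> bool"  (infix "\<ggreater>" 50) where
  "f \<ggreater> g \<longleftrightarrow> (\<exists>c>0. \<forall>\<^sub>F n in sequentially. f n \<ge> c * g n)"

end

theory Submission
  imports Defs "HOL-Real_Asymp.Real_Asymp"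
begin

text \<open>
  Write \<open>S(N) = card (S \<inter> {1..N})\<close>. The growth condition with \<open>\<lambda> > 1\<close> gives
  \<open>(B(2N) - B(N)) log B(N) = o(B(N))\<close>. Lorentz's greedy covering argument on dyadic blocks produces
  a set \<open>C\<close> with \<open>C + B\<close> cofinite and \<open>C(N) = O(N log B(N) / B(N))\<close>; hence \<open>C(N) = o(N)\<close> and
  \<open>C(N) (B(N) - B(\<epsilon>N)) = o(N)\<close> for every \<open>\<epsilon> > 0\<close>. The latter says that, for \<open>a \<le> N\<close>,
  all but \<open>\<epsilon>N + o(N)\<close> elements of \<open>C + B\<close> in \<open>(a, N]\<close> are only represented with a summand of
  \<open>C\<close> exceeding \<open>a\<close>. Now thin out \<open>C\<close>: keep \<open>a \<in> C\<close> iff \<open>(A + B)(a) \<le> \<alpha> a\<close>, where \<open>A\<close> is the set of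
  elements kept. Comparing \<open>N\<close> with the last element kept gives \<open>(A + B)(N) \<le> \<alpha> N + o(N)\<close>, and
  comparing it with the last element rejected gives \<open>(A + B)(N) \<ge> \<alpha> N - o(N)\<close>.
\<close>

subsection \<open>Thinning out an additive complement\<close>

text \<open>The rule for keeping \<open>a\<close> refers to the set under construction, so it is run
  in stages: stage \<open>n\<close> holds the elements kept up to \<open>n\<close>, which is all
  that the verdict on \<open>Suc n\<close> consults.\<close>

primrec greedy_stage :: "nat set \<Rightarrow> nat set \<Rightarrow> real \<Rightarrow> nat \<Rightarrow> nat set" where
  "greedy_stage C B \<alpha> 0 = {}"
| "greedy_stage C B \<alpha> (Suc n) =
     (if Suc n \<in> C \<and> real (card ((greedy_stage C B \<alpha> n + B) \<inter> {1..Suc n})) \<le> \<alpha> * real (Suc n)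
      then insert (Suc n) (greedy_stage C B \<alpha> n) else greedy_stage C B \<alpha> n)"

lemma greedy_stage_subset: "greedy_stage C B \<alpha> n \<subseteq> C \<inter> {1..n}"
  by (induction n) auto

lemma greedy_stage_Int:
  assumes "m \<le> n"
  shows "greedy_stage C B \<alpha> n \<inter> {..m} = greedy_stage C B \<alpha> m"
  using assms
proof (induction n rule: dec_induct)
  case base
  then show ?case using greedy_stage_subset[of C B \<alpha> m] by auto
next
  case (step n)
  then show ?case by auto
qed

text \<open>Elements of \<open>B\<close> are positive, so sums up to \<open>a\<close> only involve
  elements of \<open>A\<close> below \<open>a\<close>. The self-referential criterion is therefore a
  well-founded recursion, solved by the union of the coherent stages.\<close>

lemma greedy_subset_exists:
  fixes B C :: "nat set" and \<alpha> :: real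
  assumes B: "B \<subseteq> {1..}" and C: "C \<subseteq> {1..}"
  obtains A where "A \<subseteq> C"
    and "\<And>a. a \<in> C \<Longrightarrow> a \<in> A \<longleftrightarrow> real (card ((A + B) \<inter> {1..a})) \<le> \<alpha> * real a"
proof
  define A where "A = (\<Union>n. greedy_stage C B \<alpha> n)"
  show "A \<subseteq> C" using greedy_stage_subset unfolding A_def by fast
  have A_Int: "A \<inter> {..m} = greedy_stage C B \<alpha> m" for m
  proof (intro equalityI subsetI)
    fix x assume "x \<in> A \<inter> {..m}"
    then obtain n where n: "x \<in> greedy_stage C B \<alpha> n" "x \<le> m" unfolding A_def by auto
    show "x \<in> greedy_stage C B \<alpha> m"
    proof (cases "m \<le> n")
      case True
      then show ?thesis using n greedy_stage_Int[OF True, of C B \<alpha>] by auto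
    next
      case False
      then have "n \<le> m" by simp
      then show ?thesis using n greedy_stage_Int[of n m C B \<alpha>] by auto
    qed
  next
    fix x assume "x \<in> greedy_stage C B \<alpha> m"
    then show "x \<in> A \<inter> {..m}" using greedy_stage_subset[of C B \<alpha> m] unfolding A_def by auto
  qed
  fix a assume a: "a \<in> C"
  then obtain m where m: "a = Suc m" using C by (cases a) auto
  \<comment> \<open>With \<open>a = Suc m\<close>, a sum of at most \<open>a\<close> leaves at most
    \<open>m\<close> for the summand from \<open>A\<close>.\<close>
  have "(A + B) \<inter> {1..a} = (A \<inter> {..m} + B) \<inter> {1..a}"
    using B m by (fastforce elim!: set_plus_elim intro!: set_plus_intro)
  then have eq: "(A + B) \<inter> {1..a} = (greedy_stage C B \<alpha> m + B) \<inter> {1..a}"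
    by (simp add: A_Int)
  have "a \<in> A \<longleftrightarrow> a \<in> greedy_stage C B \<alpha> a" using A_Int[of a] by auto
  also have "\<dots> \<longleftrightarrow> real (card ((A + B) \<inter> {1..a})) \<le> \<alpha> * real a"
    unfolding eq using a greedy_stage_subset[of C B \<alpha> m] by (auto simp: m)
  finally show "a \<in> A \<longleftrightarrow> real (card ((A + B) \<inter> {1..a})) \<le> \<alpha> * real a" .
qed

text \<open>A sum \<open>x + y > a\<close> with \<open>x \<le> a\<close> either stays within
  \<open>\<epsilon> * N\<close> of \<open>a\<close> or has \<open>y > \<epsilon> * N\<close>. The
  first kind is bounded by the length of an interval, the second by the number of pairs
  \<open>(x, y)\<close>.\<close>

lemma card_late_sums_le:
  fixes B C :: "nat set" and \<epsilon> :: real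
  assumes C: "C \<subseteq> {1..}" and \<epsilon>: "\<epsilon> > 0" and a: "a \<le> N"
  shows "real (card ((C \<inter> {..a} + B) \<inter> {a<..N}))
    \<le> \<epsilon> * N + real (card (C \<inter> {1..N})) * real (card {x \<in> B. \<epsilon> * N < x \<and> x \<le> N})"
proof -
  define D where "D = {x \<in> B. \<epsilon> * N < x \<and> x \<le> N}"
  define m where "m = nat \<lfloor>\<epsilon> * N\<rfloor>"
  have finD: "finite D" by (rule finite_subset[of _ "{..N}"]) (auto simp: D_def)
  have m: "real m \<le> \<epsilon> * N" using \<epsilon> by (simp add: m_def)
  have m': "\<epsilon> * N < real x" if "x > m" for x
  proof -
    have "\<lfloor>\<epsilon> * N\<rfloor> < int x" using that unfolding m_def by linarith
    then show ?thesis by (simp add: floor_less_iff)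
  qed
  have "(C \<inter> {..a} + B) \<inter> {a<..N} \<subseteq> {a<..a + m} \<union> (\<lambda>(x, y). x + y) ` ((C \<inter> {1..N}) \<times> D)"
  proof
    fix n assume n: "n \<in> (C \<inter> {..a} + B) \<inter> {a<..N}"
    then obtain x y where xy: "n = x + y" "x \<in> C" "x \<le> a" "y \<in> B" by (auto elim!: set_plus_elim)
    show "n \<in> {a<..a + m} \<union> (\<lambda>(x, y). x + y) ` ((C \<inter> {1..N}) \<times> D)"
    proof (cases "n \<le> a + m")
      case True
      then show ?thesis using n by auto
    next
      case False
      then have "y > m" using xy by linarith
      then have "y \<in> D" using xy n m' by (auto simp: D_def)
      moreover have "x \<in> C \<inter> {1..N}" using xy a C by auto
      ultimately have "(x, y) \<in> (C \<inter> {1..N}) \<times> D" by blast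
      then show ?thesis using xy(1) by (intro UnI2 image_eqI[of _ _ "(x, y)"]) auto
    qed
  qed
  then have "card ((C \<inter> {..a} + B) \<inter> {a<..N})
      \<le> card ({a<..a + m} \<union> (\<lambda>(x, y). x + y) ` ((C \<inter> {1..N}) \<times> D))"
    using finD by (intro card_mono) auto
  also have "\<dots> \<le> card {a<..a + m} + card ((\<lambda>(x, y). x + y) ` ((C \<inter> {1..N}) \<times> D))"
    by (rule card_Un_le)
  also have "\<dots> \<le> m + card ((C \<inter> {1..N}) \<times> D)"
    using finD by (intro add_mono card_image_le) auto
  finally have "real (card ((C \<inter> {..a} + B) \<inter> {a<..N}))
      \<le> real m + real (card (C \<inter> {1..N}) * card D)"
    by (simp add: card_cartesian_product flip: of_nat_add of_nat_mult)
  then show ?thesis using m unfolding D_def by simp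
qed

text \<open>By \<open>late\<close>, sums in \<open>(a, N]\<close> with a \<open>C\<close>-summand at
  most \<open>a\<close> are negligible, so there \<open>A + B\<close> is governed by the elements of
  \<open>A\<close> in \<open>(a, N]\<close>. Taking \<open>a\<close> to be the last kept or last
  rejected element makes these none or all of the elements of \<open>C\<close> in that
  range.\<close>

lemma exists_subset_sumset_density:
  fixes B C :: "nat set" and \<alpha> :: real
  assumes B: "B \<subseteq> {1..}" and C: "C \<subseteq> {1..}" and cover: "{n0<..} \<subseteq> C + B"
    and late: "\<And>\<epsilon>::real. \<epsilon> > 0 \<Longrightarrow>
      (\<lambda>N. real (card (C \<inter> {1..N})) * real (card {x \<in> B. \<epsilon> * real N < real x \<and> x \<le> N}) / real N)
        \<longlonglongrightarrow> 0"
    and \<alpha>: "\<alpha> \<in> {0..1}"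
  obtains A where "A \<subseteq> C" "has_density (A + B) \<alpha>"
proof -
  obtain A where AC: "A \<subseteq> C"
    and A: "\<And>a. a \<in> C \<Longrightarrow> a \<in> A \<longleftrightarrow> real (card ((A + B) \<inter> {1..a})) \<le> \<alpha> * real a"
    using greedy_subset_exists[OF B C] by metis
  define f where "f N = real (card ((A + B) \<inter> {1..N}))" for N
  define E where "E \<epsilon> N = real (card (C \<inter> {1..N})) * real (card {x \<in> B. \<epsilon> * real N < real x \<and> x \<le> N})"
    for \<epsilon> :: real and N :: nat
  have split: "f N = f a + real (card ((A + B) \<inter> {a<..N}))" if "a \<le> N" for a N
  proof -
    have "(A + B) \<inter> {1..N} = ((A + B) \<inter> {1..a}) \<union> ((A + B) \<inter> {a<..N})" using that by auto
    then have "card ((A + B) \<inter> {1..N}) = card ((A + B) \<inter> {1..a}) + card ((A + B) \<inter> {a<..N})"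
      by (simp only:) (rule card_Un_disjoint, auto)
    then show ?thesis by (simp add: f_def)
  qed
  have late_bound: "real (card ((C \<inter> {..a} + B) \<inter> {a<..N})) \<le> \<epsilon> * N + E \<epsilon> N"
    if "\<epsilon> > 0" "a \<le> N" for \<epsilon> :: real and a N :: nat
    using card_late_sums_le[OF C that, of B] by (simp add: E_def)
  have upper: "f N \<le> \<alpha> * N + \<epsilon> * N + E \<epsilon> N" if \<epsilon>: "\<epsilon> > 0" for \<epsilon> :: real and N :: nat
  proof (cases "A \<inter> {..N} = {}")
    case True
    then have "(A + B) \<inter> {1..N} = {}" by (fastforce elim!: set_plus_elim)
    then have "f N = 0" by (simp add: f_def)
    moreover have "0 \<le> \<alpha> * N + \<epsilon> * N + E \<epsilon> N" using \<alpha> \<epsilon> by (auto simp: E_def)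
    ultimately show ?thesis by simp
  next
    case False
    define a where "a = Max (A \<inter> {..N})"
    have a: "a \<in> A \<inter> {..N}" unfolding a_def using False by (intro Max_in) auto
    have max: "x \<le> a" if "x \<in> A" "x \<le> N" for x
      unfolding a_def using that by (intro Max_ge) auto
    have "f a \<le> \<alpha> * a" using a A AC by (auto simp: f_def)
    also have "\<dots> \<le> \<alpha> * N" using a \<alpha> by (intro mult_left_mono) auto
    finally have 1: "f a \<le> \<alpha> * N" .
    \<comment> \<open>Nothing is kept between \<open>a\<close> and \<open>N\<close>, so every sum
      gained after \<open>a\<close> uses a summand at most \<open>a\<close>.\<close>
    have "(A + B) \<inter> {a<..N} \<subseteq> (C \<inter> {..a} + B) \<inter> {a<..N}"
    proof
      fix n assume n: "n \<in> (A + B) \<inter> {a<..N}"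
      then obtain x y where xy: "n = x + y" "x \<in> A" "y \<in> B" by (auto elim!: set_plus_elim)
      then have "x \<in> C \<inter> {..a}" using n max[of x] AC by auto
      then show "n \<in> (C \<inter> {..a} + B) \<inter> {a<..N}" using xy n by auto
    qed
    then have "card ((A + B) \<inter> {a<..N}) \<le> card ((C \<inter> {..a} + B) \<inter> {a<..N})"
      by (intro card_mono) auto
    then show ?thesis using split[of a N] late_bound[OF \<epsilon>, of a N] a 1 by auto
  qed
  have lower: "f N \<ge> \<alpha> * N - n0 - \<epsilon> * N - E \<epsilon> N" if \<epsilon>: "\<epsilon> > 0" for \<epsilon> :: real and N :: nat
  proof -
    \<comment> \<open>The witness is the last rejected element; if nothing up to \<open>N\<close> is
      rejected, \<open>a = 0\<close> works because \<open>f 0 = 0\<close>.\<close>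
    obtain a where a: "a \<le> N" "f a \<ge> \<alpha> * a" "\<And>x. x \<in> C \<Longrightarrow> a < x \<Longrightarrow> x \<le> N \<Longrightarrow> x \<in> A"
    proof (cases "(C - A) \<inter> {..N} = {}")
      case True
      then show ?thesis by (intro that[of 0]) (auto simp: f_def)
    next
      case False
      define a where "a = Max ((C - A) \<inter> {..N})"
      have a: "a \<in> (C - A) \<inter> {..N}" unfolding a_def using False by (intro Max_in) auto
      have max: "x \<le> a" if "x \<in> C - A" "x \<le> N" for x
        unfolding a_def using that by (intro Max_ge) auto
      show ?thesis
        using a A[of a] max by (intro that[of a]) (force simp: f_def)+
    qed
    \<comment> \<open>Beyond \<open>n0\<close> each \<open>n\<close> has a representation in
      \<open>C + B\<close>: a \<open>C\<close>-summand above \<open>a\<close> was kept, and one at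
      most \<open>a\<close> makes \<open>n\<close> one of the few early sums.\<close>
    have "{a<..N} \<subseteq> ((A + B) \<inter> {a<..N}) \<union> ((C \<inter> {..a} + B) \<inter> {a<..N}) \<union> {1..n0}"
    proof
      fix n assume n: "n \<in> {a<..N}"
      show "n \<in> ((A + B) \<inter> {a<..N}) \<union> ((C \<inter> {..a} + B) \<inter> {a<..N}) \<union> {1..n0}"
      proof (cases "n \<le> n0")
        case False
        then have "n \<in> C + B" using cover by auto
        then obtain x y where xy: "n = x + y" "x \<in> C" "y \<in> B" by (auto elim!: set_plus_elim)
        show ?thesis
        proof (cases "x \<le> a")
          case True
          then have "x \<in> C \<inter> {..a}" using xy by auto
          then show ?thesis using xy n by auto
        next
          case False
          then have "x \<in> A" using xy n by (intro a(3)) auto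
          then show ?thesis using xy n by auto
        qed
      qed (use n in auto)
    qed
    then have "card {a<..N}
        \<le> card (((A + B) \<inter> {a<..N}) \<union> ((C \<inter> {..a} + B) \<inter> {a<..N}) \<union> {1..n0})"
      by (intro card_mono) auto
    also have "\<dots> \<le> card ((A + B) \<inter> {a<..N}) + card ((C \<inter> {..a} + B) \<inter> {a<..N}) + card {1..n0}"
      by (intro order.trans[OF card_Un_le] add_mono order.refl card_Un_le)
    finally have "real N - a
        \<le> real (card ((A + B) \<inter> {a<..N})) + real (card ((C \<inter> {..a} + B) \<inter> {a<..N})) + n0"
      by simp
    \<comment> \<open>Here \<open>\<alpha> \<le> 1\<close> enters: covering nearly all of
      \<open>(a, N]\<close> gains at least the required \<open>\<alpha> * (N - a)\<close>, up to the
      error.\<close>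
    moreover have "\<alpha> * (real N - a) \<le> 1 * (real N - a)"
      using \<alpha> a by (intro mult_right_mono) auto
    ultimately show ?thesis
      using split[OF a(1)] late_bound[OF \<epsilon> a(1)] a(2) by (simp add: algebra_simps)
  qed
  have "(\<lambda>N. f N / N) \<longlonglongrightarrow> \<alpha>"
  proof (rule LIMSEQ_I)
    fix r :: real assume r: "r > 0"
    \<comment> \<open>At most three error terms occur, each at most \<open>\<epsilon> * N\<close>,
      so they sum to less than \<open>r * N\<close>.\<close>
    define \<epsilon> where "\<epsilon> = r / 4"
    have \<epsilon>: "\<epsilon> > 0" using r by (simp add: \<epsilon>_def)
    have "eventually (\<lambda>N. E \<epsilon> N / N < \<epsilon>) sequentially"
      using order_tendstoD(2)[OF late[OF \<epsilon>] \<epsilon>] by (simp add: E_def)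
    moreover have "eventually (\<lambda>N. real n0 / real N < \<epsilon>) sequentially"
      using \<epsilon> by real_asymp
    moreover have "eventually (\<lambda>N::nat. N > 0) sequentially" by (rule eventually_gt_at_top)
    ultimately have "eventually (\<lambda>N. norm (f N / N - \<alpha>) < r) sequentially"
    proof eventually_elim
      case (elim N)
      have 1: "E \<epsilon> N < \<epsilon> * N" "n0 < \<epsilon> * N" using elim by (auto simp: field_simps)
      have 2: "0 < \<epsilon> * N" using \<epsilon> elim by simp
      have "\<bar>f N - \<alpha> * N\<bar> < r * N"
        using upper[OF \<epsilon>, of N] lower[OF \<epsilon>, of N] 1 2 by (auto simp: \<epsilon>_def abs_less_iff)
      moreover have "f N / N - \<alpha> = (f N - \<alpha> * N) / N" using elim by (simp add: field_simps)
      ultimately show ?case using elim by (simp add: abs_divide field_simps)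
    qed
    then show "\<exists>no. \<forall>n\<ge>no. norm (f n / n - \<alpha>) < r" by (simp add: eventually_sequentially)
  qed
  then show ?thesis using AC that unfolding has_density_def f_def by blast
qed

subsection \<open>Economical covering\<close>

text \<open>Averaging over all candidates in \<open>J\<close>, some translate of \<open>D\<close> covers a proportion
  \<open>card D / card J\<close> of what is still uncovered.\<close>

lemma greedy_covering_step:
  fixes U D J :: "nat set"
  assumes fin: "finite U" "finite D" "finite J"
    and J: "\<And>u d. u \<in> U \<Longrightarrow> d \<in> D \<Longrightarrow> d \<le> u \<and> u - d \<in> J"
  shows "\<exists>A\<subseteq>J. card A \<le> s \<and>
    real (card (U - (A + D))) \<le> real (card U) * (1 - real (card D) / real (card J)) ^ s"
proof (induction s)
  case 0
  show ?case by (intro exI[of _ "{}"]) (auto intro!: card_mono fin)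
next
  case (Suc s)
  then obtain A where A: "A \<subseteq> J" "card A \<le> s"
    "real (card (U - (A + D))) \<le> real (card U) * (1 - real (card D) / real (card J)) ^ s" by blast
  define V where "V = U - (A + D)"
  have finV: "finite V" using fin by (simp add: V_def)
  show ?case
  \<comment> \<open>In the degenerate cases \<open>A\<close> is kept. If \<open>V\<close> is empty,
    only nonnegativity of the bound is at stake: for \<open>u\<close> in \<open>U\<close>, the
    injection \<open>d \<mapsto> u - d\<close> of \<open>D\<close> into \<open>J\<close> makes the
    factor nonnegative. If \<open>D\<close> is empty, the factor is 1.\<close>
  proof (cases "V = {} \<or> D = {}")
    case True
    then consider "V = {}" | "D = {}" by blast
    then show ?thesis
    proof cases
      case 1
      have "card D \<le> card J" if "u \<in> U" for u
      proof -
        have "inj_on (\<lambda>d. u - d) D" using J[OF that] by (auto simp: inj_on_def) (metis diff_diff_cancel)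
        then show ?thesis using J[OF that] fin by (intro card_inj_on_le[of "\<lambda>d. u - d"]) auto
      qed
      then have "0 \<le> real (card U) * (1 - real (card D) / real (card J)) ^ Suc s"
        by (cases "U = {}") (auto simp: divide_le_eq_1 intro!: mult_nonneg_nonneg zero_le_power)
      moreover have "card (U - (A + D)) = 0" using 1 by (simp only: V_def card.empty)
      ultimately show ?thesis using A by (intro exI[of _ A]) simp
    next
      case 2
      then show ?thesis using A by (intro exI[of _ A]) auto
    qed
  next
    case False
    then obtain v d where "v \<in> V" "d \<in> D" by auto
    then have Jne: "J \<noteq> {}" using J[of v d] by (auto simp: V_def)
    define g where "g a = card {u \<in> V. \<exists>d\<in>D. u = a + d}" for a
    \<comment> \<open>Double counting of triples with \<open>u = a + d\<close>: a pair
      \<open>(u, d)\<close> determines \<open>a\<close>, and a pair \<open>(a, u)\<close> admits at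
      most one \<open>d\<close>.\<close>
    have "real (card V) * real (card D) = (\<Sum>u\<in>V. \<Sum>d\<in>D. \<Sum>a\<in>J. if u = a + d then 1 else (0::real))"
    proof -
      have "(\<Sum>a\<in>J. if u = a + d then 1 else (0::real)) = 1" if "u \<in> V" "d \<in> D" for u d
      proof -
        have *: "d \<le> u" "u - d \<in> J" using J[of u d] that by (auto simp: V_def)
        have "(\<Sum>a\<in>J. if u = a + d then 1 else (0::real)) = (\<Sum>a\<in>J. if a = u - d then 1 else 0)"
          using * by (intro sum.cong) auto
        then show ?thesis using * fin by simp
      qed
      then show ?thesis by simp
    qed
    also have "\<dots> = (\<Sum>a\<in>J. \<Sum>u\<in>V. \<Sum>d\<in>D. if u = a + d then 1 else (0::real))"
      by (subst (2) sum.swap, subst sum.swap) simp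
    also have "\<dots> = (\<Sum>a\<in>J. real (g a))"
    proof (intro sum.cong refl)
      fix a
      have "(\<Sum>d\<in>D. if u = a + d then 1 else (0::real)) = (if \<exists>d\<in>D. u = a + d then 1 else 0)" for u
      proof (cases "\<exists>d\<in>D. u = a + d")
        case True
        then obtain d0 where d0: "d0 \<in> D" "u = a + d0" by blast
        then have "(\<Sum>d\<in>D. if u = a + d then 1 else (0::real)) = (\<Sum>d\<in>D. if d = d0 then 1 else 0)"
          by (intro sum.cong) auto
        then show ?thesis using True d0 fin by simp
      qed (auto intro!: sum.neutral)
      then show "(\<Sum>u\<in>V. \<Sum>d\<in>D. if u = a + d then 1 else (0::real)) = real (g a)"
        using finV by (simp add: g_def sum.If_cases Int_def)
    qed
    finally have total: "real (card V) * real (card D) = (\<Sum>a\<in>J. real (g a))" .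
    \<comment> \<open>Some candidate covers at least the average number of uncovered
      elements.\<close>
    obtain a where a: "a \<in> J" "real (g a) \<ge> real (card V) * real (card D) / real (card J)"
    proof (rule ccontr)
      assume "\<not> thesis"
      then have "\<And>a. a \<in> J \<Longrightarrow> real (g a) < real (card V) * real (card D) / real (card J)"
        using that by force
      then have "(\<Sum>a\<in>J. real (g a)) < (\<Sum>a\<in>J. real (card V) * real (card D) / real (card J))"
        using fin Jne by (intro sum_strict_mono) auto
      then show False using total fin Jne by simp
    qed
    have sub: "U - (insert a A + D) \<subseteq> V - {u \<in> V. \<exists>d\<in>D. u = a + d}"
      by (auto simp: V_def set_plus_def)
    have gle: "g a \<le> card V" unfolding g_def using finV by (intro card_mono) auto
    have "card (U - (insert a A + D)) \<le> card (V - {u \<in> V. \<exists>d\<in>D. u = a + d})"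
      using finV sub by (intro card_mono) auto
    also have "\<dots> = card V - g a" using finV by (simp add: card_Diff_subset g_def)
    finally have "real (card (U - (insert a A + D))) \<le> real (card V) - real (g a)"
      using gle by linarith
    also have "\<dots> \<le> real (card V) * (1 - real (card D) / real (card J))"
      using a(2) by (simp add: algebra_simps)
    also have "\<dots> \<le> (real (card U) * (1 - real (card D) / real (card J)) ^ s)
        * (1 - real (card D) / real (card J))"
    proof (rule mult_right_mono)
      have "real (card V) * real (card D) / real (card J) \<le> real (card V)"
        using a(2) gle by linarith
      moreover have "card V > 0" using False finV by (simp add: card_gt_0_iff)
      ultimately show "0 \<le> 1 - real (card D) / real (card J)"
        by (simp add: field_simps divide_le_eq split: if_splits)
    qed (use A(3) in \<open>simp add: V_def\<close>)
    finally have "real (card (U - (insert a A + D)))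
        \<le> real (card U) * (1 - real (card D) / real (card J)) ^ Suc s" by (simp add: mult_ac)
    moreover have "insert a A \<subseteq> J" "card (insert a A) \<le> Suc s"
      using a A card_insert_le_m1[of "Suc s" A a] by auto
    ultimately show ?thesis by blast
  qed
qed

text \<open>About \<open>(card J / card D) * ln (card D)\<close> greedy rounds leave at most
  \<open>card U / card D\<close> elements uncovered; from then on it is affordable to spend one
  translate on each.\<close>

lemma economical_covering:
  fixes U D J :: "nat set"
  assumes fin: "finite U" "finite D" "finite J" and D: "D \<noteq> {}"
    and J: "\<And>u d. u \<in> U \<Longrightarrow> d \<in> D \<Longrightarrow> d \<le> u \<and> u - d \<in> J"
  obtains A where "A \<subseteq> J" "U \<subseteq> A + D"
    "real (card A) \<le> (real (card J) * ln (real (card D)) + real (card U)) / real (card D) + 1"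
proof (cases "U = {}")
  case True
  show ?thesis using True D fin by (intro that[of "{}"]) (auto simp: card_gt_0_iff Suc_le_eq)
next
  case False
  define k where "k = real (card D)"
  define P where "P = real (card J)"
  obtain d0 where d0: "d0 \<in> D" using D by blast
  obtain u0 where u0: "u0 \<in> U" using False by blast
  have k: "k \<ge> 1" using D fin by (simp add: k_def Suc_le_eq card_gt_0_iff)
  have kP: "k \<le> P"
  proof -
    have "inj_on (\<lambda>d. u0 - d) D" using J[OF u0] by (auto simp: inj_on_def) (metis diff_diff_cancel)
    then have "card D \<le> card J" using J[OF u0] fin by (intro card_inj_on_le[of "\<lambda>d. u0 - d"]) auto
    then show ?thesis by (simp add: k_def P_def)
  qed
  \<comment> \<open>The least number of rounds for which \<open>exp (- (s * k / P))\<close> is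
    guaranteed to be at most \<open>1 / k\<close>.\<close>
  define s where "s = nat \<lceil>P * ln k / k\<rceil>"
  have s: "P * ln k / k \<le> s" "s \<le> P * ln k / k + 1"
    using k kP unfolding s_def by (auto simp: real_nat_ceiling_ge)
  obtain A where A: "A \<subseteq> J" "card A \<le> s" "real (card (U - (A + D))) \<le> real (card U) * (1 - k / P) ^ s"
    using greedy_covering_step[OF fin J, of s] unfolding k_def P_def by blast
  have "(1 - k / P) ^ s \<le> exp (- (k / P)) ^ s"
    using k kP exp_ge_add_one_self[of "- (k / P)"] by (intro power_mono) auto
  also have "\<dots> = exp (- (s * k / P))" by (simp flip: exp_of_nat_mult)
  also have "\<dots> \<le> exp (- ln k)" using s(1) k kP by (simp add: field_simps)
  also have "\<dots> = 1 / k" using k by (simp add: exp_minus inverse_eq_divide)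
  finally have "real (card U) * (1 - k / P) ^ s \<le> real (card U) * (1 / k)"
    by (intro mult_left_mono) auto
  then have left: "real (card (U - (A + D))) \<le> real (card U) / k" using A(3) by simp
  define A' where "A' = A \<union> (\<lambda>u. u - d0) ` (U - (A + D))"
  have "A' \<subseteq> J" using A J d0 by (auto simp: A'_def)
  moreover have "U \<subseteq> A' + D"
  proof
    fix u assume u: "u \<in> U"
    show "u \<in> A' + D"
    proof (cases "u \<in> A + D")
      case True
      then show ?thesis by (auto simp: A'_def set_plus_def)
    next
      case False
      then have "u - d0 \<in> A'" using u by (auto simp: A'_def)
      then have "(u - d0) + d0 \<in> A' + D" using d0 by blast
      then show ?thesis using J[OF u d0] by simp
    qed
  qed
  moreover have "card A' \<le> card A + card (U - (A + D))"
    unfolding A'_def using fin by (intro order.trans[OF card_Un_le] add_mono card_image_le) auto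
  then have "real (card A') \<le> (P * ln k + real (card U)) / k + 1"
    using A(2) left s(2) unfolding add_divide_distrib by linarith
  ultimately show ?thesis using that unfolding k_def P_def by blast
qed

subsection \<open>Slow variation of the counting function\<close>

text \<open>The indices \<open>i\<close> with \<open>b i \<le> x\<close> form a finite initial
  segment of the positive integers, whose length is the number of elements of \<open>B\<close> up to
  \<open>x\<close>.\<close>

lemma enum_le_iff_le_card:
  fixes B :: "nat set" and b :: "nat \<Rightarrow> nat"
  assumes B: "B \<subseteq> {1..}" and b: "strict_mono_on {1..} b" and img: "b ` {1..} = B" and i: "i \<ge> 1"
  shows "b i \<le> x \<longleftrightarrow> i \<le> card (B \<inter> {1..x})"
proof -
  define K where "K = {i. i \<ge> 1 \<and> b i \<le> x}"
  have less: "b i < b j" if "1 \<le> i" "i < j" for i j using b that by (auto simp: strict_mono_on_def)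
  have inj: "inj_on b {1..}" using b by (rule strict_mono_on_imp_inj_on)
  have eq: "B \<inter> {1..x} = b ` K" using img B by (auto simp: K_def)
  have finK: "finite K"
    using finite_imageD[of b K] eq inj_on_subset[OF inj, of K]
    by (metis (no_types, lifting) K_def atLeast_iff finite_Int finite_atLeastAtMost mem_Collect_eq subsetI)
  have card: "card (B \<inter> {1..x}) = card K"
    unfolding eq by (rule card_image, rule inj_on_subset[OF inj]) (auto simp: K_def)
  have "K = {1..card K}"
  proof (cases "K = {}")
    case False
    define M where "M = Max K"
    have M: "M \<in> K" unfolding M_def using finK False by (rule Max_in)
    have "K = {1..M}"
    proof (intro equalityI subsetI)
      fix j assume "j \<in> K"
      then show "j \<in> {1..M}" using finK by (auto simp: K_def M_def)
    next
      fix j assume "j \<in> {1..M}"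
      then show "j \<in> K" using M less[of j M] by (cases "j = M") (auto simp: K_def)
    qed
    then show ?thesis by simp
  qed auto
  then have "i \<in> K \<longleftrightarrow> i \<in> {1..card K}" by simp
  moreover have "i \<in> K \<longleftrightarrow> b i \<le> x" using i by (simp add: K_def)
  ultimately show ?thesis using i unfolding card by simp
qed

text \<open>The elements of \<open>B\<close> in \<open>(x, 2x]\<close> span at most
  \<open>ln 2\<close> on the logarithmic scale, while each gap between consecutive ones contributes
  at least a fixed amount. The \<open>- 1\<close> is there because gaps, not elements, are
  counted.\<close>

lemma doubling_count_le:
  fixes B :: "nat set" and b :: "nat \<Rightarrow> nat" and l c :: real
  defines "\<beta> \<equiv> \<lambda>x. card (B \<inter> {1..x})"
  assumes B: "B \<subseteq> {1..}" and b: "strict_mono_on {1..} b" and img: "b ` {1..} = B"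
    and c: "c > 0" and l: "l > 0"
    and gap: "\<And>n. n \<ge> n0 \<Longrightarrow> ln (real (b (n + 1)) / real (b n)) \<ge> c * (ln (real n) powr l / real n)"
    and x: "\<beta> x \<ge> n0" "\<beta> x \<ge> 1"
  shows "(real (\<beta> (2 * x)) - real (\<beta> x) - 1) * (c * ln (real (\<beta> x)) powr l)
    \<le> ln 2 * real (\<beta> (2 * x))"
proof (cases "\<beta> (2 * x) \<le> \<beta> x + 1")
  case True
  then have "(real (\<beta> (2 * x)) - real (\<beta> x) - 1) * (c * ln (real (\<beta> x)) powr l) \<le> 0"
    using c by (intro mult_nonpos_nonneg) auto
  also have "0 \<le> ln 2 * real (\<beta> (2 * x))" by simp
  finally show ?thesis .
next
  case False
  define n where "n = \<beta> x"
  define m where "m = \<beta> (2 * x)"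
  have nm: "n + 1 < m" using False by (simp add: n_def m_def)
  have bpos: "b i > 0" if "i \<ge> 1" for i using that img B by fastforce
  have lo: "b (n + 1) > x" using enum_le_iff_le_card[OF B b img, of "n + 1" x] by (simp add: n_def \<beta>_def)
  have hi: "b m \<le> 2 * x"
    using enum_le_iff_le_card[OF B b img, of m "2 * x"] nm by (simp add: m_def \<beta>_def)
  have xpos: "x > 0" using x(2) by (cases x) (auto simp: \<beta>_def)
  \<comment> \<open>A common lower bound for all gaps: the logarithm is taken at the smallest index
    \<open>n\<close>, the denominator at the largest index \<open>m\<close>. The gaps are then
    telescoped.\<close>
  define t where "t = c * ln (real n) powr l / m"
  have ind: "real i * t \<le> ln (b (n + 1 + i)) - ln (b (n + 1))"
    if "n + 1 + i \<le> m" for i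
    using that
  proof (induction i)
    case (Suc i)
    define q where "q = n + 1 + i"
    have q: "q \<ge> n0" "n \<le> q" "q \<le> m" "q \<ge> 1" using x Suc by (auto simp: q_def n_def)
    have "t \<le> c * (ln (real q) powr l / q)"
      using q c l x(2) nm unfolding t_def times_divide_eq_right
      by (intro frac_le mult_left_mono powr_mono2) (auto simp: n_def)
    also have "\<dots> \<le> ln (b (q + 1) / b q)" using gap q by simp
    also have "\<dots> = ln (b (q + 1)) - ln (b q)" using bpos[of q] bpos[of "q + 1"] q by (simp add: ln_div)
    finally show ?case using Suc by (simp add: q_def algebra_simps)
  qed simp
  have "real (m - (n + 1)) * t \<le> ln (b m) - ln (b (n + 1))"
    using ind[of "m - (n + 1)"] nm by simp
  also have "\<dots> \<le> ln (2 * real x) - ln (real x)"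
    using lo hi xpos bpos[of m] nm by (intro diff_mono ln_mono) (auto simp: Suc_le_eq)
  also have "\<dots> = ln 2" using xpos by (simp add: ln_mult)
  finally have "(real m - real n - 1) * (c * ln (real n) powr l) / m \<le> ln 2"
    using nm by (simp add: of_nat_diff t_def diff_diff_eq add.commute)
  then show ?thesis using nm by (simp add: divide_le_eq n_def m_def)
qed

text \<open>The previous bound makes the increment \<open>O(n / (ln n) powr l + 1)\<close> with
  \<open>n = \<beta> x\<close>. Multiplying by \<open>ln n / n\<close> leaves a quantity tending to
  0 exactly because \<open>l > 1\<close>.\<close>

lemma doubling_increment_tendsto_0:
  fixes B :: "nat set" and b :: "nat \<Rightarrow> nat" and l c :: real
  defines "\<beta> \<equiv> \<lambda>x. card (B \<inter> {1..x})"
  assumes B: "B \<subseteq> {1..}" and b: "strict_mono_on {1..} b" and img: "b ` {1..} = B"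
    and c: "c > 0" and l: "l > 1"
    and gap: "\<And>n. n \<ge> n0 \<Longrightarrow> ln (real (b (n + 1)) / real (b n)) \<ge> c * (ln (real n) powr l / real n)"
    and lim: "filterlim \<beta> at_top sequentially"
  shows "(\<lambda>x. (real (\<beta> (2 * x)) - real (\<beta> x)) * ln (real (\<beta> x)) / real (\<beta> x)) \<longlonglongrightarrow> 0"
proof -
  define h where "h n = 2 * ln 2 / c * (ln (real n) / ln (real n) powr l) + 2 * (ln (real n) / real n)"
    for n :: nat
  have "h \<longlonglongrightarrow> 0" unfolding h_def using l c by real_asymp
  then have h: "(\<lambda>x. h (\<beta> x)) \<longlonglongrightarrow> 0" using lim by (rule filterlim_compose)
  have "eventually (\<lambda>n::nat. c * ln (real n) powr l \<ge> 2 * ln 2) sequentially"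
    using c l by real_asymp
  moreover have "eventually (\<lambda>n::nat. n \<ge> max 3 n0) sequentially" by (rule eventually_ge_at_top)
  ultimately have ev: "eventually (\<lambda>n::nat. c * ln (real n) powr l \<ge> 2 * ln 2 \<and> n \<ge> max 3 n0) sequentially"
    by (rule eventually_conj)
  have bound: "eventually (\<lambda>x. (real (\<beta> (2 * x)) - real (\<beta> x)) * ln (real (\<beta> x)) / real (\<beta> x) \<le> h (\<beta> x))
      sequentially"
    using eventually_compose_filterlim[OF ev lim]
  proof eventually_elim
    case (elim x)
    define n where "n = real (\<beta> x)"
    define k where "k = real (\<beta> (2 * x)) - n"
    define L where "L = c * ln n powr l"
    have n: "n \<ge> 3" using elim by (simp add: n_def)
    have L: "L \<ge> 2 * ln 2" using elim by (simp add: L_def n_def)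
    have Lpos: "L > 0" using L ln_gt_zero[of "2::real"] by linarith
    have "(k - 1) * L \<le> ln 2 * (n + k)"
    proof -
      have "(real (\<beta> (2 * x)) - real (\<beta> x) - 1) * (c * ln (real (\<beta> x)) powr l)
          \<le> ln 2 * real (\<beta> (2 * x))"
        unfolding \<beta>_def
        by (rule doubling_count_le[OF B b img c _ gap]) (use elim l in \<open>auto simp: \<beta>_def\<close>)
      then show ?thesis by (simp add: k_def n_def L_def)
    qed
    moreover have "k \<ge> 0"
      unfolding k_def n_def \<beta>_def by (auto intro!: card_mono)
    \<comment> \<open>The term in \<open>k\<close> on the right is absorbed into half of
      \<open>k * L\<close>; this is why \<open>L\<close> was required to be at least
      \<open>2 * ln 2\<close>.\<close>
    then have "ln 2 * k \<le> L / 2 * k" using L by (intro mult_right_mono) auto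
    ultimately have "k * L \<le> 2 * ln 2 * n + 2 * L" by (simp add: algebra_simps)
    then have "k \<le> 2 * ln 2 * n / L + 2" using Lpos by (simp add: field_simps)
    then have "k * (ln n / n) \<le> (2 * ln 2 * n / L + 2) * (ln n / n)"
      using n by (intro mult_right_mono) auto
    also have "\<dots> = h (\<beta> x)" using n c by (simp add: h_def L_def n_def field_simps)
    finally show ?case by (simp add: k_def n_def)
  qed
  have nonneg: "eventually (\<lambda>x. 0 \<le> (real (\<beta> (2 * x)) - real (\<beta> x)) * ln (real (\<beta> x)) / real (\<beta> x)) sequentially"
    using eventually_compose_filterlim[OF ev lim]
  proof eventually_elim
    case (elim x)
    have "\<beta> x \<le> \<beta> (2 * x)" unfolding \<beta>_def by (auto intro!: card_mono)
    then show ?case using elim by auto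
  qed
  show ?thesis by (rule tendsto_sandwich[OF nonneg bound tendsto_const h])
qed

subsection \<open>A sparse additive complement\<close>

lemma tendsto_0_dyadic:
  fixes f g :: "nat \<Rightarrow> real"
  assumes g: "g \<longlonglongrightarrow> 0"
    and bound: "\<And>J N. J \<ge> J0 \<Longrightarrow> 2 ^ J \<le> N \<Longrightarrow> N < 2 ^ (J + 1) \<Longrightarrow> \<bar>f N\<bar> \<le> g J"
  shows "f \<longlonglongrightarrow> 0"
proof (rule LIMSEQ_I)
  fix r :: real assume "r > 0"
  then have "eventually (\<lambda>J. g J < r) sequentially" using g by (intro order_tendstoD(2))
  then obtain J1 where J1: "\<And>J. J \<ge> J1 \<Longrightarrow> g J < r" by (auto simp: eventually_sequentially)
  show "\<exists>no. \<forall>n\<ge>no. norm (f n - 0) < r"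
  proof (intro exI allI impI)
    fix N :: nat assume N: "N \<ge> 2 ^ (max J0 J1)"
    then have "N \<ge> 1" using one_le_power[of "2::nat" "max J0 J1"] by linarith
    then obtain J where J: "2 ^ J \<le> N" "N < 2 ^ (J + 1)" using ex_power_ivl1[of 2 N] by auto
    have "(2::nat) ^ max J0 J1 < 2 ^ (J + 1)" using J N by linarith
    then have "max J0 J1 < J + 1" by (rule power_less_imp_less_exp[rotated]) simp
    then show "norm (f N - 0) < r" using bound[of J N] J J1[of J] by auto
  qed
qed

text \<open>The terms \<open>2 ^ i * w i\<close> grow by a factor of at least 4/3, and the geometric
  series of ratio 3/4 sums to 4.\<close>

lemma geometric_sum_le_last:
  fixes w :: "nat \<Rightarrow> real"
  assumes w: "\<And>i. i \<ge> i0 \<Longrightarrow> 0 \<le> w i \<and> w i \<le> 3 / 2 * w (Suc i)" and J: "i0 \<le> J"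
  shows "(\<Sum>i=i0..J. 2 ^ i * w i) \<le> 4 * 2 ^ J * w J"
  using J
proof (induction J rule: dec_induct)
  case base
  then show ?case using w[of i0] by simp
next
  case (step J)
  have "(\<Sum>i=i0..Suc J. 2 ^ i * w i) \<le> 4 * 2 ^ J * w J + 2 ^ Suc J * w (Suc J)"
    using step by (simp add: sum.cl_ivl_Suc)
  also have "4 * 2 ^ J * w J \<le> 4 * 2 ^ J * (3 / 2 * w (Suc J))"
    using w[of J] step by (intro mult_left_mono) auto
  finally show ?case by (simp del: sum.cl_ivl_Suc add: mult_ac)
qed

text \<open>Each dyadic block is covered separately by translates of an initial part of
  \<open>B\<close>. Slow variation of \<open>\<beta>\<close> makes the costs grow geometrically, so
  the last block dominates the count of \<open>C\<close>.\<close>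

lemma sparse_additive_complement:
  fixes B :: "nat set"
  defines "\<beta> \<equiv> \<lambda>x. card (B \<inter> {1..x})"
  assumes B: "B \<subseteq> {1..}" and lim: "filterlim \<beta> at_top sequentially"
    and incr: "(\<lambda>x. (real (\<beta> (2 * x)) - real (\<beta> x)) * ln (real (\<beta> x)) / real (\<beta> x)) \<longlonglongrightarrow> 0"
  obtains C n0 where "C \<subseteq> {1..}" "{n0<..} \<subseteq> C + B" "has_density C 0"
    "\<And>\<epsilon>::real. \<epsilon> > 0 \<Longrightarrow>
      (\<lambda>N. real (card (C \<inter> {1..N})) * real (card {x \<in> B. \<epsilon> * real N < real x \<and> x \<le> N}) / real N)
        \<longlonglongrightarrow> 0"
proof -
  define \<gamma> where "\<gamma> i = real (\<beta> (2 ^ i))" for i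
  \<comment> \<open>Up to a constant, \<open>2 ^ i * w i\<close> is the cost of covering the block
    at scale \<open>2 ^ i\<close>.\<close>
  define w where "w i = ln (\<gamma> i) / \<gamma> i" for i
  have pow_lim: "filterlim (\<lambda>i::nat. 2 ^ i :: nat) at_top sequentially"
    by (rule filterlim_at_top_mono[OF filterlim_ident]) (auto intro!: always_eventually less_imp_le)
  have \<gamma>_lim: "filterlim \<gamma> at_top sequentially"
    unfolding \<gamma>_def
    by (intro filterlim_compose[OF filterlim_real_sequentially] filterlim_compose[OF lim] pow_lim)
  have \<gamma>_mono: "\<gamma> i \<le> \<gamma> j" if "i \<le> j" for i j
  proof -
    have "(2::nat) ^ i \<le> 2 ^ j" using that by (intro power_increasing) auto
    then have "B \<inter> {1..2 ^ i} \<subseteq> B \<inter> {1..2 ^ j}" by (intro Int_mono) auto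
    then show ?thesis by (auto simp only: \<gamma>_def \<beta>_def of_nat_le_iff intro!: card_mono)
  qed
  have r: "(\<lambda>i. (\<gamma> (Suc i) - \<gamma> i) * w i) \<longlonglongrightarrow> 0"
    using filterlim_compose[OF incr pow_lim] by (simp add: \<gamma>_def w_def)
  have "eventually (\<lambda>i. (\<gamma> (Suc i) - \<gamma> i) * w i < 1 / 2) sequentially"
    by (rule order_tendstoD(2)[OF r]) simp
  moreover have "eventually (\<lambda>i. \<gamma> i \<ge> 3) sequentially"
    using \<gamma>_lim by (simp add: filterlim_at_top)
  ultimately have "eventually (\<lambda>i. \<gamma> i \<ge> 3 \<and> (\<gamma> (Suc i) - \<gamma> i) * w i < 1 / 2) sequentially"
    by eventually_elim simp
  \<comment> \<open>Since \<open>3 \<ge> exp 1\<close>, from \<open>i0\<close> on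
    \<open>ln (\<gamma> i) \<ge> 1\<close> and \<open>w\<close> is decreasing; the bound 1/2 limits
    the growth of \<open>\<gamma>\<close> at each doubling to a factor 3/2.\<close>
  then obtain i0 where \<gamma>3: "\<And>i. i \<ge> i0 \<Longrightarrow> \<gamma> i \<ge> 3"
    and small: "\<And>i. i \<ge> i0 \<Longrightarrow> (\<gamma> (Suc i) - \<gamma> i) * w i < 1 / 2"
    by (auto simp: eventually_sequentially)
  have ln\<gamma>: "ln (\<gamma> i) \<ge> 1" if "i \<ge> i0" for i
    using \<gamma>3[OF that] exp_le by (subst ln_ge_iff) auto
  have wpos: "w i > 0" if "i \<ge> i0" for i using \<gamma>3[OF that] ln\<gamma>[OF that] by (simp add: w_def)
  have wanti: "w j \<le> w i" if "i0 \<le> i" "i \<le> j" for i j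
    unfolding w_def using \<gamma>3[of i] exp_le that \<gamma>_mono by (intro ln_x_over_x_mono) auto
  have wratio: "w i \<le> 3 / 2 * w (Suc i)" if i: "i \<ge> i0" for i
  proof -
    have g: "\<gamma> i \<ge> 3" "\<gamma> (Suc i) \<ge> 3" "ln (\<gamma> i) \<ge> 1" "\<gamma> i \<le> \<gamma> (Suc i)"
      using \<gamma>3 ln\<gamma> i \<gamma>_mono by auto
    have "(\<gamma> (Suc i) - \<gamma> i) * 1 \<le> (\<gamma> (Suc i) - \<gamma> i) * ln (\<gamma> i)"
      using g by (intro mult_left_mono) auto
    also have "\<dots> < \<gamma> i / 2" using small[OF i] g by (simp add: w_def field_simps)
    finally have le: "\<gamma> (Suc i) \<le> 3 / 2 * \<gamma> i" by simp
    have "ln (\<gamma> i) / \<gamma> i \<le> ln (\<gamma> (Suc i)) / (2 / 3 * \<gamma> (Suc i))"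
      using g le by (intro frac_le ln_mono) auto
    then show ?thesis by (simp add: w_def)
  qed
  \<comment> \<open>Subtracting an element of \<open>B\<close> up to \<open>2 ^ i\<close> from the
    block \<open>(2 ^ (i + 1), 2 ^ (i + 2)]\<close> lands in an interval of \<open>3 * 2 ^ i\<close>
    candidates. The constant is 6 = 3 + 2 + 1: greedy rounds, leftovers and rounding.\<close>
  have "\<exists>F. F \<subseteq> {2 ^ i<..2 ^ (i + 2)} \<and> {2 ^ (i + 1)<..2 ^ (i + 2)} \<subseteq> F + B
      \<and> real (card F) \<le> 6 * (2 ^ i * w i)" if i: "i \<ge> i0" for i
  proof -
    have g: "\<gamma> i \<ge> 3" "ln (\<gamma> i) \<ge> 1" using \<gamma>3 ln\<gamma> i by auto
    define D where "D = B \<inter> {1..2 ^ i}"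
    have cD: "real (card D) = \<gamma> i" by (simp add: D_def \<gamma>_def \<beta>_def)
    have "card D \<le> card {1..2 ^ i :: nat}" unfolding D_def by (intro card_mono) auto
    then have \<gamma>le: "\<gamma> i \<le> 2 ^ i" using cD by (simp flip: of_nat_le_iff[where 'a = real])
    have Dne: "D \<noteq> {}" using cD g by auto
    obtain F where F: "F \<subseteq> {2 ^ i<..2 ^ (i + 2)}" "{2 ^ (i + 1)<..2 ^ (i + 2)} \<subseteq> F + D"
      "real (card F) \<le> (real (card {2 ^ i<..2 ^ (i + 2) :: nat}) * ln (real (card D))
          + real (card {2 ^ (i + 1)<..2 ^ (i + 2) :: nat})) / real (card D) + 1"
      by (rule economical_covering[of "{2 ^ (i + 1)<..2 ^ (i + 2)}" D "{2 ^ i<..2 ^ (i + 2)}"])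
        (use Dne in \<open>auto simp: D_def\<close>)
    have "real (card F) \<le> (3 * 2 ^ i * ln (\<gamma> i) + 2 * 2 ^ i) / \<gamma> i + 1"
      using F(3) unfolding cD by (simp add: of_nat_diff algebra_simps)
    also have "\<dots> \<le> (3 * 2 ^ i * ln (\<gamma> i) + 2 * 2 ^ i * ln (\<gamma> i)) / \<gamma> i + 2 ^ i * ln (\<gamma> i) / \<gamma> i"
    proof (intro add_mono divide_right_mono order.refl)
      show "2 * 2 ^ i \<le> 2 * 2 ^ i * ln (\<gamma> i)" using g by simp
      have "\<gamma> i * 1 \<le> 2 ^ i * ln (\<gamma> i)" using g \<gamma>le by (intro mult_mono) auto
      then show "1 \<le> 2 ^ i * ln (\<gamma> i) / \<gamma> i" using g by simp
    qed (use g in auto)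
    also have "\<dots> = 6 * (2 ^ i * w i)" by (simp add: w_def add_divide_distrib)
    finally have "real (card F) \<le> 6 * (2 ^ i * w i)" .
    moreover have "F + D \<subseteq> F + B" by (intro set_plus_mono2) (auto simp: D_def)
    ultimately show ?thesis using F(1,2) by blast
  qed
  then obtain F where F: "\<And>i. i \<ge> i0 \<Longrightarrow> F i \<subseteq> {2 ^ i<..2 ^ (i + 2)}"
    "\<And>i. i \<ge> i0 \<Longrightarrow> {2 ^ (i + 1)<..2 ^ (i + 2)} \<subseteq> F i + B"
    "\<And>i. i \<ge> i0 \<Longrightarrow> real (card (F i)) \<le> 6 * (2 ^ i * w i)"
    by metis
  define C where "C = (\<Union>i\<in>{i0..}. F i)"
  have C_pos: "C \<subseteq> {1..}" using F(1) by (fastforce simp: C_def)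
  have cover: "{2 ^ (i0 + 1)<..} \<subseteq> C + B"
  proof
    fix n :: nat assume n: "n \<in> {2 ^ (i0 + 1)<..}"
    moreover have "(1::nat) \<le> 2 ^ (i0 + 1)" by (rule one_le_power) simp
    ultimately have "2 \<le> n" unfolding greaterThan_iff by linarith
    then obtain j where j: "2 ^ j < n" "n \<le> 2 ^ (j + 1)" using ex_power_ivl2[of 2 n] by auto
    have "(2::nat) ^ (i0 + 1) < 2 ^ (j + 1)" using j n unfolding greaterThan_iff by linarith
    then have "i0 + 1 < j + 1" by (rule power_less_imp_less_exp[rotated]) simp
    then obtain i where i: "j = i + 1" "i \<ge> i0" by (cases j) auto
    then have "n \<in> F i + B" using F(2)[OF i(2)] j by auto
    then show "n \<in> C + B" using i by (auto simp: C_def set_plus_def)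
  qed
  \<comment> \<open>\<open>F i\<close> lies beyond \<open>2 ^ i\<close>, so only blocks with
    \<open>i \<le> J\<close> contribute, and 24 = 6 * 4.\<close>
  have count: "real (card (C \<inter> {1..N})) \<le> 24 * 2 ^ J * w J"
    if J: "J \<ge> i0" and N: "N < 2 ^ (J + 1)" for J N
  proof -
    have "C \<inter> {1..N} \<subseteq> (\<Union>i\<in>{i0..J}. F i)"
    proof
      fix x assume x: "x \<in> C \<inter> {1..N}"
      then obtain i where i: "i \<ge> i0" "x \<in> F i" by (auto simp: C_def)
      have "(2::nat) ^ i < x" using F(1)[OF i(1)] i by auto
      also have "\<dots> < 2 ^ (J + 1)" using x N by simp
      finally have "i < J + 1" by (rule power_less_imp_less_exp[rotated]) simp
      then show "x \<in> (\<Union>i\<in>{i0..J}. F i)" using i by auto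
    qed
    moreover have fin: "finite (F i)" if "i \<ge> i0" for i using F(1)[OF that] by (rule finite_subset) simp
    ultimately have "card (C \<inter> {1..N}) \<le> card (\<Union>i\<in>{i0..J}. F i)"
      by (intro card_mono) auto
    also have "\<dots> \<le> (\<Sum>i=i0..J. card (F i))" by (rule card_UN_le) simp
    finally have "real (card (C \<inter> {1..N})) \<le> (\<Sum>i=i0..J. real (card (F i)))"
      by (simp flip: of_nat_sum)
    also have "\<dots> \<le> (\<Sum>i=i0..J. 6 * (2 ^ i * w i))" using F(3) by (intro sum_mono) auto
    also have "\<dots> = 6 * (\<Sum>i=i0..J. 2 ^ i * w i)" by (simp add: sum_distrib_left)
    also have "\<dots> \<le> 6 * (4 * 2 ^ J * w J)"
      using wpos wratio J by (intro mult_left_mono geometric_sum_le_last) (auto intro: less_imp_le)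
    finally show ?thesis by simp
  qed
  have count': "real (card (C \<inter> {1..N})) / N \<le> 24 * w J"
    if J: "J \<ge> i0" and N: "2 ^ J \<le> N" "N < 2 ^ (J + 1)" for J N
  proof -
    have N': "(2::real) ^ J \<le> real N" using N(1) by (metis of_nat_le_iff of_nat_numeral of_nat_power)
    have "real (card (C \<inter> {1..N})) \<le> 24 * w J * 2 ^ J" using count[OF J N(2)] by (simp add: mult_ac)
    also have "\<dots> \<le> 24 * w J * N" using N' wpos[OF J] by (intro mult_left_mono) auto
    finally show ?thesis using N N' by (simp add: divide_le_eq)
  qed
  have density: "has_density C 0"
    unfolding has_density_def
  proof (rule tendsto_0_dyadic)
    have "((\<lambda>x::real. ln x / x) \<longlongrightarrow> 0) at_top" by real_asymp
    then have "w \<longlonglongrightarrow> 0" unfolding w_def using \<gamma>_lim by (rule filterlim_compose)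
    then show "(\<lambda>J. 24 * w J) \<longlonglongrightarrow> 0" by (rule tendsto_mult_right_zero)
  qed (use count' in auto)
  have late: "(\<lambda>N. real (card (C \<inter> {1..N})) * real (card {x \<in> B. \<epsilon> * real N < real x \<and> x \<le> N}) / real N)
        \<longlonglongrightarrow> 0" if \<epsilon>: "\<epsilon> > 0" for \<epsilon> :: real
  proof -
    \<comment> \<open>Then \<open>\<epsilon> * N > 2 ^ (J - m)\<close> for
      \<open>N \<ge> 2 ^ J\<close>, so the relevant part of \<open>B\<close> spans a fixed number
      \<open>m + 1\<close> of doublings.\<close>
    obtain m where m: "(1 / 2) ^ m < \<epsilon>" using real_arch_pow_inv[of \<epsilon> "1 / 2"] \<epsilon> by auto
    \<comment> \<open>The increments of \<open>m + 1\<close> successive doublings are added up; as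
      \<open>w\<close> decreases, earlier increments may be weighted by the later value.\<close>
    have shift: "(\<lambda>J. (\<gamma> (J + m + 1) - \<gamma> J) * w (J + m)) \<longlonglongrightarrow> 0" for m
    proof (induction m)
      case 0
      then show ?case using r by simp
    next
      case (Suc m)
      have 1: "(\<lambda>J. (\<gamma> (J + m + 1) - \<gamma> J) * w (J + Suc m)) \<longlonglongrightarrow> 0"
      proof (rule tendsto_sandwich[OF _ _ tendsto_const Suc])
        show "eventually (\<lambda>J. 0 \<le> (\<gamma> (J + m + 1) - \<gamma> J) * w (J + Suc m)) sequentially"
          using eventually_ge_at_top[of i0]
          by eventually_elim (auto intro!: mult_nonneg_nonneg \<gamma>_mono less_imp_le[OF wpos])
        show "eventually (\<lambda>J. (\<gamma> (J + m + 1) - \<gamma> J) * w (J + Suc m) \<le> (\<gamma> (J + m + 1) - \<gamma> J) * w (J + m))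
            sequentially"
          using eventually_ge_at_top[of i0]
          by eventually_elim (auto intro!: mult_left_mono \<gamma>_mono wanti)
      qed
      have "(\<lambda>J. (\<gamma> (Suc (J + Suc m)) - \<gamma> (J + Suc m)) * w (J + Suc m)) \<longlonglongrightarrow> 0"
        by (rule LIMSEQ_ignore_initial_segment[OF r])
      from tendsto_add[OF this 1] show ?case by (simp add: algebra_simps)
    qed
    \<comment> \<open>Reindexing by \<open>m\<close>; truncation of \<open>J - m\<close> affects
      only finitely many \<open>J\<close>.\<close>
    have "(\<lambda>J. (\<gamma> (J + 1) - \<gamma> (J - m)) * w J) \<longlonglongrightarrow> 0"
      by (rule LIMSEQ_offset[where k = m]) (use shift[of m] in simp)
    then have lim0: "(\<lambda>J. 24 * ((\<gamma> (J + 1) - \<gamma> (J - m)) * w J)) \<longlonglongrightarrow> 0"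
      by (rule tendsto_mult_right_zero)
    show ?thesis
    proof (rule tendsto_0_dyadic[OF lim0])
      fix J N :: nat assume J: "J \<ge> max i0 m" and N: "2 ^ J \<le> N" "N < 2 ^ (J + 1)"
      define X where "X = {x \<in> B. \<epsilon> * real N < real x \<and> x \<le> N}"
      have "X \<subseteq> (B \<inter> {1..2 ^ (J + 1)}) - (B \<inter> {1..2 ^ (J - m)})"
      proof
        fix x assume x: "x \<in> X"
        have "(2::real) ^ (J - m) = (1 / 2) ^ m * 2 ^ J"
          using J by (simp add: power_diff power_divide)
        also have "\<dots> \<le> \<epsilon> * N"
          using m \<epsilon> N(1)[THEN of_nat_mono, where 'a = real] by (intro mult_mono) auto
        also have "\<dots> < x" using x by (simp add: X_def)
        finally have "2 ^ (J - m) < x" by (metis of_nat_less_iff of_nat_numeral of_nat_power)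
        then show "x \<in> (B \<inter> {1..2 ^ (J + 1)}) - (B \<inter> {1..2 ^ (J - m)})"
          using x N B by (auto simp: X_def)
      qed
      then have "card X \<le> card ((B \<inter> {1..2 ^ (J + 1)}) - (B \<inter> {1..2 ^ (J - m)}))"
        by (intro card_mono) auto
      also have "\<dots> = card (B \<inter> {1..2 ^ (J + 1)}) - card (B \<inter> {1..2 ^ (J - m)})"
      proof (rule card_Diff_subset)
        have "(2::nat) ^ (J - m) \<le> 2 ^ (J + 1)" by (rule power_increasing) auto
        then show "B \<inter> {1..2 ^ (J - m)} \<subseteq> B \<inter> {1..2 ^ (J + 1)}" by auto
      qed simp
      finally have X: "real (card X) \<le> \<gamma> (J + 1) - \<gamma> (J - m)"
        using \<gamma>_mono[of "J - m" "J + 1"] unfolding \<gamma>_def \<beta>_def by linarith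
      have "real (card (C \<inter> {1..N})) / N * real (card X) \<le> 24 * w J * (\<gamma> (J + 1) - \<gamma> (J - m))"
        using J N X wpos[of J] by (intro mult_mono count') auto
      then show "\<bar>real (card (C \<inter> {1..N})) * real (card {x \<in> B. \<epsilon> * real N < real x \<and> x \<le> N}) / real N\<bar>
          \<le> 24 * ((\<gamma> (J + 1) - \<gamma> (J - m)) * w J)"
        unfolding X_def[symmetric] by (simp add: mult_ac)
    qed
  qed
  show ?thesis by (rule that[OF C_pos cover density late])
qed

section \<open>Deducing the density statement from the sparse complement\<close>

lemma has_density_0_subset:
  assumes "has_density C 0" "A \<subseteq> C"
  shows "has_density A 0"
proof -
  have "card (A \<inter> {1..n}) \<le> card (C \<inter> {1..n})" for n using assms(2) by (intro card_mono) auto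
  then show ?thesis
    using assms(1) unfolding has_density_def
    by (elim tendsto_sandwich[OF _ _ tendsto_const, rotated -1])
      (auto intro!: always_eventually divide_right_mono)
qed

theorem theorem1p8:
  fixes B :: "nat set" and b :: "nat \<Rightarrow> nat"
  assumes "B \<subseteq> {1..}" and "infinite B"
    and "strict_mono_on {1..} b" and "b ` {1..} = B"
    and "\<exists>l::real. l > 1 \<and>
           (\<lambda>n. ln (real (b (n + 1)) / real (b n))) \<ggreater> (\<lambda>n. ln (real n) powr l / real n)"
  shows "\<forall>\<alpha>::real\<in>{0..1}. \<exists>A\<subseteq>{1..}. has_density A 0 \<and> has_density (A + B) \<alpha>"
proof
  fix \<alpha> :: real assume \<alpha>: "\<alpha> \<in> {0..1}"
  obtain l c :: real and n0 where l: "l > 1" and c: "c > 0"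
    and gap: "\<And>n. n \<ge> n0 \<Longrightarrow> ln (real (b (n + 1)) / real (b n)) \<ge> c * (ln (real n) powr l / real n)"
    using assms(5) unfolding vinogradov_gg_def eventually_sequentially by blast
  have lim: "filterlim (\<lambda>x. card (B \<inter> {1..x})) at_top sequentially"
    unfolding filterlim_at_top eventually_sequentially
  proof (intro allI exI impI)
    fix Z x assume "b (Suc Z) \<le> x"
    then show "Z \<le> card (B \<inter> {1..x})"
      using enum_le_iff_le_card[OF assms(1,3,4), of "Suc Z" x] by simp
  qed
  show "\<exists>A\<subseteq>{1..}. has_density A 0 \<and> has_density (A + B) \<alpha>"
  \<comment> \<open>One complement \<open>C\<close> serves every \<open>\<alpha>\<close>; its
    thinned subset \<open>A\<close> inherits density 0.\<close>
  proof (rule sparse_additive_complement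
      [OF assms(1) lim doubling_increment_tendsto_0[OF assms(1,3,4) c l gap lim]])
    fix C m
    assume C: "C \<subseteq> {1..}" "{m<..} \<subseteq> C + B" "has_density C 0"
      and late: "\<And>\<epsilon>::real. \<epsilon> > 0 \<Longrightarrow>
        (\<lambda>N. real (card (C \<inter> {1..N})) * real (card {x \<in> B. \<epsilon> * real N < real x \<and> x \<le> N}) / real N)
          \<longlonglongrightarrow> 0"
    obtain A where "A \<subseteq> C" "has_density (A + B) \<alpha>"
      by (rule exists_subset_sumset_density[OF assms(1) C(1,2) late \<alpha>])
    then show ?thesis using C has_density_0_subset by blast
  qed
qed

end
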